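(* Put $A(p)=\int_0^1\arctan^p(x)\,dx$, and let $t(k)=\sum_{n\ge1}\frac{1}{(2n-1)^k}$ for $k\ge2$ and $t(\bar k)=\sum_{n\ge1}\frac{(-1)^n}{(2n-1)^k}=-\beta(k)$ for $k\ge1$, where $\beta(k)=\sum_{n\ge1}\frac{(-1)^{n-1}}{(2n-1)^k}$; $t^{j}(\bar 1)$ denotes the $j$-th power of $t(\bar1)=-\pi/4$. For any positive integer $m$, \begin{align*} \int_0^1 \frac{\arctan^{2m}(x)}{x}dx={}&t^{2m-1}(\bar 1)\big(t(\bar{2})+t(2)\big)+\frac{(-1)^{m}(2m-1)!}{2^{2m}}S(2,\{1\}_{2m-2},\bar{1})\\ &+(2m-1)!\sum_{u=0}^{m-1}\frac{(-1)^uA(2m-2u-1)}{(2m-2u-1)!\,2^{2u+1}}T(2,\{1\}_{2u})\\ &-(2m-1)!\sum_{v=1}^{m-1}\frac{(-1)^{v+1}t^{2m-2v-1}(\bar 1)}{2^{2v+1}(2m-2v-1)!}\left(T(2,\{1\}_{2v})+T(2,\{1\}_{2v-1},\bar{1})\right)\\ &-(2m-1)!\sum_{v=1}^{m-1}\frac{(-1)^{v}t^{2m-2v}(\bar 1)}{2^{2v}(2m-2v)!}\left(S(2,\{1\}_{2v-1})-S(2,\{1\}_{2v-2},\bar{1})\right) \end{align*} and \begin{align*} \int_0^1 \frac{\arctan^{2m+1}(x)}{x}dx={}&-t^{2m}(\bar 1)\big(t(\bar{2})+t(2)\big)-\frac{(-1)^{m}(2m)!}{2^{2m+1}}T(2,\{1\}_{2m-1},\bar{1})\\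 &+(2m)!\sum_{u=0}^{m-1}\frac{(-1)^uA(2m-2u)}{(2m-2u)!\,2^{2u+1}}T(2,\{1\}_{2u})\\ &-(2m)!\sum_{v=1}^{m-1}\frac{(-1)^{v}t^{2m-2v}(\bar 1)}{2^{2v+1}(2m-2v)!}\left(T(2,\{1\}_{2v})+T(2,\{1\}_{2v-1},\bar{1})\right)\\ &-(2m)!\sum_{v=0}^{m-1}\frac{(-1)^{v}t^{2m-2v-1}(\bar 1)}{2^{2v+2}(2m-2v-1)!}\left(S(2,\{1\}_{2v+1})-S(2,\{1\}_{2v},\bar{1})\right). \end{align*}
   Context: For $n\in\mathbb{N}$, $(k_1,\dots,k_r)\in\mathbb{N}^r$ and $\sigma_1,\dots,\sigma_r\in\{\pm1\}$ the alternating multiple $T$- and $S$-harmonic sums are given recursively: they equal $1$ for $r=0$, and for $r\ge1$, writing $T_j'=T_j^{\sigma_2,\dots,\sigma_r}(k_2,\dots,k_r)$ and $S_j'=S_j^{\sigma_2,\dots,\sigma_r}(k_2,\dots,k_r)$, $$T_n^{\sigma_1,\dots,\sigma_r}(k_1,\dots,k_r)=\begin{cases}2\sum_{j=1}^{n}\dfrac{\sigma_1^jT_j'}{(2j-1)^{k_1}},& r\text{ odd},\\[2mm]2\sum_{j=1}^{n-1}\dfrac{\sigma_1^jT_j'}{(2j)^{k_1}},& r\text{ even},\end{cases}\quad S_n^{\sigma_1,\dots,\sigma_r}(k_1,\dots,k_r)=\begin{cases}2\sum_{j=1}^{n-1}\dfrac{\sigma_1^jS_j'}{(2j)^{k_1}},&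 r\text{ odd},\\[2mm]2\sum_{j=1}^{n}\dfrac{\sigma_1^jS_j'}{(2j-1)^{k_1}},& r\text{ even}.\end{cases}$$ For $(k_1,\sigma_1)\ne(1,1)$ the alternating multiple $T$- and $S$-values are $T^{\boldsymbol\sigma}(\boldsymbol k)=\lim_{n\to\infty}T_n^{\boldsymbol\sigma}(\boldsymbol k)$ and $S^{\boldsymbol\sigma}(\boldsymbol k)=\lim_{n\to\infty}S_n^{\boldsymbol\sigma}(\boldsymbol k)$. They are written $T(k_1,\dots,k_r)$, $S(k_1,\dots,k_r)$ with a bar placed over $k_j$ exactly when $\sigma_j=-1$. $\{1\}_p$ means $1$ repeated $p$ times. Empty sums are $0$. *)

theory Defs
  imports "HOL-Analysis.Analysis"
begin

text \<open>A signed index is a pair of an exponent \<open>k \<ge> 1\<close> and a sign \<open>\<sigma> \<in> {1, -1}\<close>;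
  the sign \<open>-1\<close> is the bar of the usual notation. An index word is a list of
  signed indices, with the outermost summation at the head of the list.\<close>

type_synonym sindex = "nat \<times> int"

abbreviation nobar :: "nat \<Rightarrow> sindex" where "nobar k \<equiv> (k, 1)"

abbreviation bar :: "nat \<Rightarrow> sindex" where "bar k \<equiv> (k, - 1)"

abbreviation ones :: "nat \<Rightarrow> sindex list" where "ones p \<equiv> replicate p (nobar 1)"

text \<open>The parity in the two recursions is that of the depth of the current word, so it
  alternates with every step inwards. The upper limit \<open>n - 1\<close> is rendered by the half-open
  interval \<open>{1..<n}\<close>.\<close>

fun T_sum :: "sindex list \<Rightarrow> nat \<Rightarrow> real" where
  "T_sum [] n = 1"
| "T_sum ((k, \<sigma>) # w) n =
     (if odd (length ((k, \<sigma>) # w))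
      then 2 * (\<Sum>j = 1..n. of_int \<sigma> ^ j * T_sum w j / (2 * real j - 1) ^ k)
      else 2 * (\<Sum>j = 1..<n. of_int \<sigma> ^ j * T_sum w j / (2 * real j) ^ k))"

fun S_sum :: "sindex list \<Rightarrow> nat \<Rightarrow> real" where
  "S_sum [] n = 1"
| "S_sum ((k, \<sigma>) # w) n =
     (if odd (length ((k, \<sigma>) # w))
      then 2 * (\<Sum>j = 1..<n. of_int \<sigma> ^ j * S_sum w j / (2 * real j) ^ k)
      else 2 * (\<Sum>j = 1..n. of_int \<sigma> ^ j * S_sum w j / (2 * real j - 1) ^ k))"

text \<open>These limits are meaningful when the head of the word is not \<open>nobar 1\<close>.\<close>

definition T_val :: "sindex list \<Rightarrow> real" where
  "T_val w = lim (\<lambda>n. T_sum w n)"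

definition S_val :: "sindex list \<Rightarrow> real" where
  "S_val w = lim (\<lambda>n. S_sum w n)"

text \<open>Both \<open>t(k)\<close>, for \<open>k \<ge> 2\<close>, and its barred version, for \<open>k \<ge> 1\<close>. The summation index
  \<open>n \<ge> 1\<close> is shifted to start at \<open>0\<close>, so the sign is \<open>\<sigma> ^ (n + 1)\<close>; the series is the limit
  of its partial sums, hence conditional convergence (at \<open>bar 1\<close>) is covered.\<close>

definition t_val :: "sindex \<Rightarrow> real" where
  "t_val = (\<lambda>(k, \<sigma>). \<Sum>n. of_int \<sigma> ^ (n + 1) / (2 * real (n + 1) - 1) ^ k)"

definition A_int :: "nat \<Rightarrow> real" where
  "A_int p = integral {0..1} (\<lambda>x::real. arctan x ^ p)"

end

theory Submission
  imports Defs
begin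

text \<open>
  Expanding one factor \<open>arctan x / x\<close> into its power series reduces both integrals to the
  series of the moments \<open>\<integral> x^(2n) arctan^p x\<close> with weights \<open>1 / (2n + 1)\<close>. Integrating the
  derivative of \<open>(x^(n+3) + x^(n+1)) arctan^(p+1) x\<close> relates consecutive moments of exponent
  \<open>p + 1\<close> to one of exponent \<open>p\<close>; summing over \<open>n\<close> expresses the suitably normalised
  moments of exponent \<open>p + 1\<close> through a \<open>T\<close>- or \<open>S\<close>-type harmonic sum of those of
  exponent \<open>p\<close>, plus constant and alternating boundary terms coming from \<open>x = 1\<close> and from
  \<open>A(p + 1)\<close>. Iterating down to \<open>p = 0\<close> turns the boundary terms into multiple \<open>T\<close>- and
  \<open>S\<close>-values. All sequences that occur are \<open>O(\<surd>n)\<close>, so that every series with outer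
  weight \<open>1 / (2n + 1)^2\<close> converges.
\<close>

section \<open>Iterated harmonic sums as operators\<close>

text \<open>Sequences are indexed from \<open>0\<close>, so that entry \<open>n\<close> belongs to the summation index
  \<open>n + 1\<close> of the sums \<open>T\<close> and \<open>S\<close>.\<close>

definition odd_sum :: "(nat \<Rightarrow> real) \<Rightarrow> nat \<Rightarrow> real" where
  "odd_sum g n = 2 * (\<Sum>j\<le>n. g j / (2 * real j + 1))"

definition even_sum :: "(nat \<Rightarrow> real) \<Rightarrow> nat \<Rightarrow> real" where
  "even_sum g n = 2 * (\<Sum>j<n. g j / (2 * real j + 2))"

text \<open>Two further indices \<open>nobar 1\<close> restore the parity of the depth, so a block
  of ones acts as a power of one operator. The order of composition fits \<open>T\<close> on words
  of even length and \<open>S\<close> on words of odd length.\<close>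

definition double_sum :: "(nat \<Rightarrow> real) \<Rightarrow> nat \<Rightarrow> real" where
  "double_sum g = even_sum (odd_sum g)"

text \<open>The sign of a barred index at summation index \<open>n + 1\<close>.\<close>

definition alt :: "nat \<Rightarrow> real" where
  "alt n = (- 1) ^ Suc n"

lemma odd_sum_lincomb:
  "odd_sum (\<lambda>n. a * g n + b * h n) = (\<lambda>n. a * odd_sum g n + b * odd_sum h n)"
  by (rule ext) (simp add: odd_sum_def sum_distrib_left add_divide_distrib sum.distrib algebra_simps)

lemma even_sum_lincomb:
  "even_sum (\<lambda>n. a * g n + b * h n) = (\<lambda>n. a * even_sum g n + b * even_sum h n)"
  by (rule ext) (simp add: even_sum_def sum_distrib_left add_divide_distrib sum.distrib algebra_simps)

lemma double_sum_power_lincomb: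
  "(double_sum ^^ k) (\<lambda>n. a * g n + b * h n)
    = (\<lambda>n. a * (double_sum ^^ k) g n + b * (double_sum ^^ k) h n)"
  by (induction k) (simp_all add: double_sum_def odd_sum_lincomb even_sum_lincomb)

section \<open>Growth of order \<open>sqrt n\<close> and its closure properties\<close>

definition sqrt_bounded :: "(nat \<Rightarrow> real) \<Rightarrow> bool" where
  "sqrt_bounded g \<longleftrightarrow> (\<exists>C\<ge>0. \<forall>n. \<bar>g n\<bar> \<le> C * sqrt (real n + 1))"

lemma sqrt_boundedI: "0 \<le> C \<Longrightarrow> (\<And>n. \<bar>g n\<bar> \<le> C * sqrt (real n + 1)) \<Longrightarrow> sqrt_bounded g"
  unfolding sqrt_bounded_def by blast

lemma sqrt_bounded_if_bounded:
  assumes "\<And>n. \<bar>g n\<bar> \<le> C"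
  shows "sqrt_bounded g"
proof (rule sqrt_boundedI)
  show C: "0 \<le> C" using assms[of 0] by linarith
  fix n
  have "C * 1 \<le> C * sqrt (real n + 1)" using C by (intro mult_left_mono) auto
  with assms[of n] show "\<bar>g n\<bar> \<le> C * sqrt (real n + 1)" by linarith
qed

lemma sqrt_bounded_one: "sqrt_bounded (\<lambda>n. 1)"
  by (rule sqrt_bounded_if_bounded[of _ 1]) simp

lemma sqrt_bounded_alt: "sqrt_bounded alt"
  by (rule sqrt_bounded_if_bounded[of _ 1]) (simp add: alt_def power_abs)

lemma sqrt_bounded_lincomb:
  assumes "sqrt_bounded g" "sqrt_bounded h"
  shows "sqrt_bounded (\<lambda>n. a * g n + b * h n)"
proof -
  obtain C D where C: "0 \<le> C" "\<And>n. \<bar>g n\<bar> \<le> C * sqrt (real n + 1)"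
    and D: "0 \<le> D" "\<And>n. \<bar>h n\<bar> \<le> D * sqrt (real n + 1)"
    using assms unfolding sqrt_bounded_def by blast
  show ?thesis
  proof (rule sqrt_boundedI)
    show "0 \<le> \<bar>a\<bar> * C + \<bar>b\<bar> * D" using C D by simp
    fix n
    have "\<bar>a * g n + b * h n\<bar> \<le> \<bar>a\<bar> * \<bar>g n\<bar> + \<bar>b\<bar> * \<bar>h n\<bar>"
      by (metis abs_mult abs_triangle_ineq)
    also have "\<dots> \<le> \<bar>a\<bar> * (C * sqrt (real n + 1)) + \<bar>b\<bar> * (D * sqrt (real n + 1))"
      by (intro add_mono mult_left_mono C D) auto
    finally show "\<bar>a * g n + b * h n\<bar> \<le> (\<bar>a\<bar> * C + \<bar>b\<bar> * D) * sqrt (real n + 1)"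
      by (simp add: algebra_simps)
  qed
qed

text \<open>Dropping the square \<open>(b - a)\<^sup>2\<close> bounds each term by twice a
  difference of consecutive roots, and these differences telescope.\<close>

lemma sum_inverse_sqrt_le: "(\<Sum>j<n. 1 / sqrt (real j + 1)) \<le> 2 * sqrt (real n)"
proof (induction n)
  case (Suc n)
  define a b where "a = sqrt (real n)" and "b = sqrt (real n + 1)"
  have b: "b > 0" "b\<^sup>2 = real n + 1" and a: "a \<ge> 0" "a\<^sup>2 = real n" 
    by (auto simp: a_def b_def)
  have "1 = b\<^sup>2 - a\<^sup>2" using a b by simp
  also have "\<dots> = 2 * b * (b - a) - (b - a)\<^sup>2" by (simp add: power2_eq_square algebra_simps)
  also have "\<dots> \<le> (2 * b - 2 * a) * b" by (simp add: algebra_simps)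
  finally have "1 / b \<le> 2 * b - 2 * a" using b by (simp add: divide_le_eq)
  then show ?case using Suc unfolding a_def b_def by (simp add: add.commute)
qed simp

text \<open>The condition on \<open>d\<close> covers odd and even denominators at once. The 8 is a
  product of three factors 2: the prefactor, the bound on \<open>d\<close>, and the sum of inverse
  roots.\<close>

lemma sum_le_sqrt:
  assumes "\<And>n. \<bar>g n\<bar> \<le> C * sqrt (real n + 1)" "0 \<le> C" "\<And>j. real j + 1 \<le> 2 * d j"
  shows "\<bar>2 * (\<Sum>j<n. g j / d j)\<bar> \<le> 8 * C * sqrt (real n)"
proof -
  have "\<bar>g j / d j\<bar> \<le> 2 * C * (1 / sqrt (real j + 1))" for j
  proof -
    have d: "d j > 0" using assms(3)[of j] by linarith
    have "\<bar>g j\<bar> / d j \<le> C * sqrt (real j + 1) / ((real j + 1) / 2)"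
      by (rule frac_le) (use assms(1,2) assms(3)[of j] in auto)
    also have "\<dots> = 2 * C * (1 / sqrt (real j + 1))"
    proof -
      define s where "s = sqrt (real j + 1)"
      have "s > 0" "real j + 1 = s * s" by (simp_all add: s_def)
      then show ?thesis unfolding s_def[symmetric] by (simp add: divide_simps)
    qed
    finally show ?thesis using d by simp
  qed
  then have "\<bar>\<Sum>j<n. g j / d j\<bar> \<le> (\<Sum>j<n. 2 * C * (1 / sqrt (real j + 1)))"
    by (rule order_trans[OF sum_abs sum_mono])
  also have "\<dots> = 2 * C * (\<Sum>j<n. 1 / sqrt (real j + 1))"
    by (rule sum_distrib_left[symmetric])
  also have "\<dots> \<le> 2 * C * (2 * sqrt (real n))"
    using assms(2) by (intro mult_left_mono sum_inverse_sqrt_le) auto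
  finally show ?thesis by (simp add: abs_mult)
qed

text \<open>Iterated sums of bounded sequences grow only like powers of a logarithm. The cruder
  square root avoids counting those powers, because a summation with weight of order
  \<open>1 / j\<close> reproduces it up to the constant.\<close>

lemma sqrt_bounded_even_sum:
  assumes "sqrt_bounded g"
  shows "sqrt_bounded (even_sum g)"
proof -
  obtain C where C: "0 \<le> C" "\<And>n. \<bar>g n\<bar> \<le> C * sqrt (real n + 1)"
    using assms unfolding sqrt_bounded_def by blast
  show ?thesis
  proof (rule sqrt_boundedI)
    show "0 \<le> 8 * C" using C by simp
    fix n
    have "\<bar>even_sum g n\<bar> \<le> 8 * C * sqrt (real n)"
      unfolding even_sum_def by (rule sum_le_sqrt) (use C in auto)
    also have "\<dots> \<le> 8 * C * sqrt (real n + 1)" using C by (intro mult_left_mono) auto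
    finally show "\<bar>even_sum g n\<bar> \<le> 8 * C * sqrt (real n + 1)" .
  qed
qed

lemma sqrt_bounded_odd_sum:
  assumes "sqrt_bounded g"
  shows "sqrt_bounded (odd_sum g)"
proof -
  obtain C where C: "0 \<le> C" "\<And>n. \<bar>g n\<bar> \<le> C * sqrt (real n + 1)"
    using assms unfolding sqrt_bounded_def by blast
  show ?thesis
  proof (rule sqrt_boundedI)
    show "0 \<le> 8 * C" using C by simp
    fix n
    have "\<bar>2 * (\<Sum>j<Suc n. g j / (2 * real j + 1))\<bar> \<le> 8 * C * sqrt (real (Suc n))"
      by (rule sum_le_sqrt) (use C in auto)
    then show "\<bar>odd_sum g n\<bar> \<le> 8 * C * sqrt (real n + 1)"
      by (simp add: odd_sum_def lessThan_Suc_atMost add.commute)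
  qed
qed

lemma sqrt_bounded_double_sum_power:
  "sqrt_bounded g \<Longrightarrow> sqrt_bounded ((double_sum ^^ k) g)"
  by (induction k) (simp_all add: double_sum_def sqrt_bounded_even_sum sqrt_bounded_odd_sum)

text \<open>The outermost summation of a word headed by 2, without its factor 2; without that factor
  it also gives \<open>t_val\<close> at exponent 2.\<close>

definition outer :: "(nat \<Rightarrow> real) \<Rightarrow> real" where
  "outer g = (\<Sum>n. g n / (2 * real n + 1)\<^sup>2)"

text \<open>Growth \<open>sqrt n\<close> against a quadratic denominator leaves a convergent series
  of exponent 3/2.\<close>

lemma outer_summable:
  assumes "sqrt_bounded g"
  shows "summable (\<lambda>n. g n / (2 * real n + 1)\<^sup>2)"
proof -
  obtain C where C: "0 \<le> C" "\<And>n. \<bar>g n\<bar> \<le> C * sqrt (real n + 1)"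
    using assms unfolding sqrt_bounded_def by blast
  have "summable (\<lambda>n. real n powr (- (3/2)))"
    by (subst summable_real_powr_iff) simp
  then have "summable (\<lambda>n. C * real (Suc n) powr (- (3/2)))"
    by (intro summable_mult) (rule summable_Suc_iff[THEN iffD2])
  then show ?thesis
  proof (rule summable_comparison_test')
    fix n :: nat
    define x where "x = real n + 1"
    have x: "x > 0" by (simp add: x_def)
    have "x\<^sup>2 \<le> (2 * real n + 1)\<^sup>2" by (rule power_mono) (simp_all add: x_def)
    moreover have "\<bar>g n\<bar> \<le> C * sqrt x" using C by (simp add: x_def)
    moreover have "0 \<le> C * sqrt x" using C x by simp
    ultimately have "\<bar>g n\<bar> / (2 * real n + 1)\<^sup>2 \<le> C * sqrt x / x\<^sup>2"
      using x by (intro frac_le) simp_all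
    moreover have "sqrt x / x\<^sup>2 = x powr (1 / 2 - 2)"
      using x by (simp only: powr_diff powr_half_sqrt less_imp_le powr_numeral)
    ultimately have "\<bar>g n\<bar> / (2 * real n + 1)\<^sup>2 \<le> C * x powr (- (3 / 2))"
      by (simp flip: times_divide_eq_right)
    then show "norm (g n / (2 * real n + 1)\<^sup>2) \<le> C * real (Suc n) powr (- (3/2))"
      by (simp add: x_def add.commute)
  qed
qed

lemma outer_lincomb:
  assumes "sqrt_bounded g" "sqrt_bounded h"
  shows "outer (\<lambda>n. a * g n + b * h n) = a * outer g + b * outer h"
proof -
  have "(\<lambda>n. a * (g n / (2 * real n + 1)\<^sup>2) + b * (h n / (2 * real n + 1)\<^sup>2))
      sums (a * outer g + b * outer h)"
    unfolding outer_def by (intro sums_add sums_mult summable_sums outer_summable assms)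
  then show ?thesis
    by (simp add: outer_def add_divide_distrib sums_iff)
qed

text \<open>Half the value of a word that starts with 2 and \<open>2 * k\<close> ones, the sequence
  \<open>g\<close> standing for the inner rest of the word.\<close>

definition value_of :: "nat \<Rightarrow> (nat \<Rightarrow> real) \<Rightarrow> real" where
  "value_of k g = outer ((double_sum ^^ k) g)"

lemma value_of_lincomb:
  "sqrt_bounded g \<Longrightarrow> sqrt_bounded h \<Longrightarrow>
    value_of k (\<lambda>n. a * g n + b * h n) = a * value_of k g + b * value_of k h"
  by (simp add: value_of_def double_sum_power_lincomb outer_lincomb sqrt_bounded_double_sum_power)

lemma value_of_double_sum: "value_of k (double_sum g) = value_of (Suc k) g"
  by (simp add: value_of_def funpow_swap1)

section \<open>Multiple \<open>T\<close>- and \<open>S\<close>-values\<close>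

declare One_nat_def [simp del]

lemma sum_shift_atMost: "(\<Sum>j = 1..Suc n. f j) = (\<Sum>j\<le>n. f (Suc j))"
  by (metis One_nat_def atMost_atLeast0 sum.shift_bounds_cl_Suc_ivl)

lemma sum_shift_lessThan: "(\<Sum>j = 1..<Suc n. f j) = (\<Sum>j<n. f (Suc j))"
  by (metis One_nat_def lessThan_atLeast0 sum.shift_bounds_Suc_ivl)

lemma T_sum_Cons_one:
  "(\<lambda>n. T_sum (nobar 1 # w) (Suc n)) =
    (if even (length w) then odd_sum else even_sum) (\<lambda>n. T_sum w (Suc n))"
  by (rule ext) (simp add: sum_shift_atMost sum_shift_lessThan odd_sum_def even_sum_def
      algebra_simps del: sum.cl_ivl_Suc sum.op_ivl_Suc)

lemma S_sum_Cons_one: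
  "(\<lambda>n. S_sum (nobar 1 # w) (Suc n)) =
    (if even (length w) then even_sum else odd_sum) (\<lambda>n. S_sum w (Suc n))"
  by (rule ext) (simp add: sum_shift_atMost sum_shift_lessThan odd_sum_def even_sum_def
      algebra_simps del: sum.cl_ivl_Suc sum.op_ivl_Suc)

lemma ones_add_one: "ones (k + 1) = ones k @ [nobar 1]"
  by (simp only: replicate_add One_nat_def replicate_Suc replicate_0)

text \<open>Ones are prepended in pairs: the first meets an even length and gives
  \<open>odd_sum\<close>, the second an odd length and gives \<open>even_sum\<close>. For
  \<open>S\<close> the roles of the parities are exchanged.\<close>

lemma T_sum_ones:
  "even (length w) \<Longrightarrow>
    (\<lambda>n. T_sum (ones (2 * u) @ w) (Suc n)) = (double_sum ^^ u) (\<lambda>n. T_sum w (Suc n))"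
  by (induction u) (simp_all add: T_sum_Cons_one double_sum_def del: T_sum.simps)

lemma S_sum_ones:
  "odd (length w) \<Longrightarrow>
    (\<lambda>n. S_sum (ones (2 * u) @ w) (Suc n)) = (double_sum ^^ u) (\<lambda>n. S_sum w (Suc n))"
  by (induction u) (simp_all add: S_sum_Cons_one double_sum_def del: S_sum.simps)

lemma T_sum_bar_one: "(\<lambda>n. T_sum [bar 1] (Suc n)) = odd_sum alt"
  by (rule ext) (simp add: sum_shift_atMost odd_sum_def alt_def algebra_simps
      del: sum.cl_ivl_Suc)

lemma S_sum_bar_one: "(\<lambda>n. S_sum [bar 1] (Suc n)) = even_sum alt"
  by (rule ext) (simp add: sum_shift_lessThan even_sum_def alt_def algebra_simps
      del: sum.op_ivl_Suc)

text \<open>Actual convergence is needed, since \<open>lim\<close> says nothing about a divergent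
  sequence.\<close>

lemma outer_LIMSEQ:
  assumes "sqrt_bounded g"
  shows "(\<lambda>n. 2 * (\<Sum>j = 1..n. g (j - 1) / (2 * real j - 1)\<^sup>2)) \<longlonglongrightarrow> 2 * outer g"
proof -
  have eq: "(\<Sum>j = 1..n. g (j - 1) / (2 * real j - 1)\<^sup>2) = (\<Sum>j<n. g j / (2 * real j + 1)\<^sup>2)" for n
    by (rule sum.reindex_bij_witness[of _ Suc "\<lambda>j. j - 1"]) (auto simp: of_nat_diff algebra_simps)
  show ?thesis unfolding eq
    using outer_summable[OF assms] unfolding outer_def
    by (intro tendsto_mult_left) (rule summable_LIMSEQ)
qed

text \<open>The parity of \<open>w\<close> places the head 2 on odd denominators; \<open>S\<close>
  needs the opposite parity for the same effect.\<close>

lemma T_val_nobar_two: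
  assumes "even (length w)" "sqrt_bounded (\<lambda>n. T_sum w (Suc n))"
  shows "T_val (nobar 2 # w) = 2 * outer (\<lambda>n. T_sum w (Suc n))"
proof -
  have "T_sum (nobar 2 # w) = (\<lambda>n. 2 * (\<Sum>j = 1..n. T_sum w (Suc (j - 1)) / (2 * real j - 1)\<^sup>2))"
    using assms(1) by (auto intro!: ext sum.cong)
  then show ?thesis unfolding T_val_def
    using outer_LIMSEQ[OF assms(2)] by (simp add: limI)
qed

lemma S_val_nobar_two:
  assumes "odd (length w)" "sqrt_bounded (\<lambda>n. S_sum w (Suc n))"
  shows "S_val (nobar 2 # w) = 2 * outer (\<lambda>n. S_sum w (Suc n))"
proof -
  have "S_sum (nobar 2 # w) = (\<lambda>n. 2 * (\<Sum>j = 1..n. S_sum w (Suc (j - 1)) / (2 * real j - 1)\<^sup>2))"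
    using assms(1) by (auto intro!: ext sum.cong)
  then show ?thesis unfolding S_val_def
    using outer_LIMSEQ[OF assms(2)] by (simp add: limI)
qed

lemma T_val_ones: "T_val (nobar 2 # ones (2 * u)) = 2 * value_of u (\<lambda>n. 1)"
proof -
  have "(\<lambda>n. T_sum (ones (2 * u)) (Suc n)) = (double_sum ^^ u) (\<lambda>n. 1)"
    using T_sum_ones[of "[]" u] by simp
  then show ?thesis
    by (simp add: T_val_nobar_two value_of_def sqrt_bounded_double_sum_power sqrt_bounded_one)
qed

text \<open>The innermost one pairs with \<open>bar 1\<close> to form \<open>double_sum alt\<close>,
  which raises the level from \<open>u\<close> to \<open>Suc u\<close>.\<close>

lemma T_val_ones_bar:
  "T_val (nobar 2 # ones (2 * u + 1) @ [bar 1]) = 2 * value_of (Suc u) alt"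
proof -
  have "(\<lambda>n. T_sum (ones (2 * u + 1) @ [bar 1]) (Suc n)) = (double_sum ^^ u) (double_sum alt)"
    using T_sum_ones[of "[nobar 1, bar 1]" u] T_sum_Cons_one[of "[bar 1]"]
    by (simp add: T_sum_bar_one double_sum_def ones_add_one del: T_sum.simps)
  then have eq: "(\<lambda>n. T_sum (ones (2 * u + 1) @ [bar 1]) (Suc n)) = (double_sum ^^ Suc u) alt"
    by (simp only: funpow_Suc_right o_apply)
  show ?thesis
    unfolding value_of_def eq[symmetric]
    by (rule T_val_nobar_two)
      (simp, simp only: eq sqrt_bounded_double_sum_power sqrt_bounded_alt)
qed

text \<open>The innermost one has no partner: at depth 1 the sum \<open>S\<close> runs over even
  denominators and leaves a single \<open>even_sum\<close>.\<close>

lemma S_val_ones: "S_val (nobar 2 # ones (2 * u + 1)) = 2 * value_of u (even_sum (\<lambda>n. 1))"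
proof -
  have "(\<lambda>n. S_sum (ones (2 * u + 1)) (Suc n)) = (double_sum ^^ u) (even_sum (\<lambda>n. 1))"
    using S_sum_ones[of "[nobar 1]" u] S_sum_Cons_one[of "[]"]
    by (simp add: ones_add_one del: S_sum.simps(2))
  then show ?thesis
    by (simp add: S_val_nobar_two value_of_def sqrt_bounded_double_sum_power sqrt_bounded_one
        sqrt_bounded_even_sum del: replicate_Suc S_sum.simps)
qed

lemma S_val_ones_bar:
  "S_val (nobar 2 # ones (2 * u) @ [bar 1]) = 2 * value_of u (even_sum alt)"
proof -
  have "(\<lambda>n. S_sum (ones (2 * u) @ [bar 1]) (Suc n)) = (double_sum ^^ u) (even_sum alt)"
    using S_sum_ones[of "[bar 1]" u] by (simp add: S_sum_bar_one del: S_sum.simps)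
  then show ?thesis
    by (simp add: S_val_nobar_two value_of_def sqrt_bounded_double_sum_power sqrt_bounded_alt
        sqrt_bounded_even_sum)
qed

section \<open>The single series \<open>t\<close>\<close>

lemma t_val_eq: "t_val (k, \<sigma>) = (\<Sum>n. of_int \<sigma> ^ Suc n / (2 * real n + 1) ^ k)"
  by (simp add: t_val_def add.commute flip: Suc_eq_plus1)

text \<open>Leibniz's series, that is, the arctangent series at 1 with the opposite sign.\<close>

lemma t_val_bar_one: "t_val (bar 1) = - (pi / 4)"
proof -
  have "(\<lambda>n. - ((- 1) ^ n * (1 / real (n * 2 + 1) * 1 ^ (n * 2 + 1)))) sums - arctan 1"
    by (subst arctan_series, simp, intro sums_minus summable_sums summable_arctan_series) simp
  then show ?thesis
    by (simp add: t_val_eq arctan_one mult.commute sums_unique[symmetric])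
qed

lemma t_val_bar_two: "t_val (bar 2) = value_of 0 alt"
  by (simp add: t_val_eq value_of_def outer_def alt_def)

lemma t_val_nobar_two: "t_val (nobar 2) = value_of 0 (\<lambda>n. 1)"
  by (simp add: t_val_eq value_of_def outer_def)

declare One_nat_def [simp]

section \<open>Moments of powers of the arctangent\<close>

definition moment :: "nat \<Rightarrow> nat \<Rightarrow> real" where
  "moment n p = integral {0..1} (\<lambda>x. x ^ n * arctan x ^ p)"

lemma moment_has_integral: "((\<lambda>x. x ^ n * arctan x ^ p) has_integral moment n p) {0..1}"
  unfolding moment_def
  by (intro integrable_integral integrable_continuous_interval continuous_intros)

lemma DERIV_power_Suc_ident:
  "((\<lambda>x::real. x ^ Suc n) has_real_derivative real (Suc n) * x ^ n) (at x within S)"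
  by (rule DERIV_cong[OF DERIV_power_Suc[OF DERIV_ident]]) simp

lemma DERIV_arctan_power_Suc:
  "((\<lambda>x. arctan x ^ Suc p) has_real_derivative real (Suc p) * arctan x ^ p / (1 + x\<^sup>2))
    (at x within S)"
  by (rule DERIV_cong[OF DERIV_power_Suc[OF DERIV_subset[OF DERIV_arctan subset_UNIV]]])
    (simp add: divide_inverse)

lemma power_has_integral_unit: "((\<lambda>x::real. x ^ n) has_integral 1 / real (Suc n)) {0..1}"
proof -
  have "((\<lambda>x::real. x ^ n) has_integral 1 ^ Suc n / real (Suc n) - 0 ^ Suc n / real (Suc n)) {0..1}"
  proof (rule fundamental_theorem_of_calculus)
    fix x :: real
    have "((\<lambda>x. x ^ Suc n / real (Suc n)) has_real_derivative x ^ n) (at x within {0..1})"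
      by (rule DERIV_cong[OF DERIV_cdivide[OF DERIV_power_Suc_ident]]) simp
    then show "((\<lambda>x. x ^ Suc n / real (Suc n)) has_vector_derivative x ^ n) (at x within {0..1})"
      by (simp only: has_real_derivative_iff_has_vector_derivative)
  qed simp
  then show ?thesis by simp
qed

lemma moment_power_zero: "moment n 0 = 1 / real (Suc n)"
  using power_has_integral_unit[of n] by (simp add: moment_def integral_unique)

text \<open>This is the recursion of \<open>moment_Suc\<close> continued to \<open>n = -1\<close>,
  where the middle term has coefficient 0. It starts the odd moments.\<close>

lemma moment_Suc_zero:
  "2 * moment 1 (Suc p) + real (Suc p) * moment 0 p = 2 * (pi / 4) ^ Suc p"
proof -
  let ?g = "\<lambda>x::real. (x ^ Suc 1 + 1) * arctan x ^ Suc p"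
  let ?f = "\<lambda>x::real. 2 * (x ^ 1 * arctan x ^ Suc p) + real (Suc p) * (x ^ 0 * arctan x ^ p)"
  have "(?f has_integral ?g 1 - ?g 0) {0..1}"
  proof (rule fundamental_theorem_of_calculus)
    fix x :: real
    have nz: "1 + x\<^sup>2 \<noteq> 0" by (metis power_one sum_power2_eq_zero_iff zero_neq_one)
    have "(?g has_real_derivative (real (Suc 1) * x ^ 1 + 0) * arctan x ^ Suc p
        + real (Suc p) * arctan x ^ p / (1 + x\<^sup>2) * (x ^ Suc 1 + 1)) (at x within {0..1})"
      by (intro DERIV_mult DERIV_add DERIV_power_Suc_ident DERIV_arctan_power_Suc DERIV_const)
    also have "x ^ Suc 1 + 1 = 1 + x\<^sup>2" by (simp add: power2_eq_square)
    also have "real (Suc p) * arctan x ^ p / (1 + x\<^sup>2) * (1 + x\<^sup>2) = real (Suc p) * (x ^ 0 * arctan x ^ p)"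
      using nz by simp
    finally show "(?g has_vector_derivative ?f x) (at x within {0..1})"
      by (simp add: has_real_derivative_iff_has_vector_derivative mult.assoc del: power_Suc)
  qed simp
  moreover have "(?f has_integral 2 * moment 1 (Suc p) + real (Suc p) * moment 0 p) {0..1}"
    by (intro has_integral_add has_integral_mult_right moment_has_integral)
  ultimately have "2 * moment 1 (Suc p) + real (Suc p) * moment 0 p = ?g 1 - ?g 0"
    by (rule has_integral_unique[symmetric])
  then show ?thesis by (simp add: arctan_one)
qed

text \<open>The polynomial factor is \<open>(1 + x\<^sup>2) * x ^ (n + 1)\<close>, so it cancels the
  denominator in the derivative of \<open>arctan\<close>.\<close>

lemma moment_Suc:
  "real (n + 3) * moment (n + 2) (Suc p) + real (n + 1) * moment n (Suc p)
    + real (Suc p) * moment (n + 1) p = 2 * (pi / 4) ^ Suc p"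
proof -
  let ?g = "\<lambda>x::real. (x ^ Suc (n + 2) + x ^ Suc n) * arctan x ^ Suc p"
  let ?f = "\<lambda>x::real. real (n + 3) * (x ^ (n + 2) * arctan x ^ Suc p)
      + real (n + 1) * (x ^ n * arctan x ^ Suc p) + real (Suc p) * (x ^ (n + 1) * arctan x ^ p)"
  have "(?f has_integral ?g 1 - ?g 0) {0..1}"
  proof (rule fundamental_theorem_of_calculus)
    fix x :: real
    have nz: "1 + x\<^sup>2 \<noteq> 0" by (metis power_one sum_power2_eq_zero_iff zero_neq_one)
    have "(?g has_real_derivative (real (Suc (n + 2)) * x ^ (n + 2) + real (Suc n) * x ^ n)
        * arctan x ^ Suc p
        + real (Suc p) * arctan x ^ p / (1 + x\<^sup>2) * (x ^ Suc (n + 2) + x ^ Suc n)) (at x within {0..1})"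
      by (intro DERIV_mult DERIV_add DERIV_power_Suc_ident DERIV_arctan_power_Suc)
    also have "x ^ Suc (n + 2) + x ^ Suc n = (1 + x\<^sup>2) * x ^ (n + 1)"
      by (simp add: algebra_simps power2_eq_square)
    also have "real (Suc p) * arctan x ^ p / (1 + x\<^sup>2) * ((1 + x\<^sup>2) * x ^ (n + 1))
        = real (Suc p) * (x ^ (n + 1) * arctan x ^ p)"
      using nz by simp
    also have "(real (Suc (n + 2)) * x ^ (n + 2) + real (Suc n) * x ^ n) * arctan x ^ Suc p
        + real (Suc p) * (x ^ (n + 1) * arctan x ^ p) = ?f x"
      by (simp add: algebra_simps)
    finally show "(?g has_vector_derivative ?f x) (at x within {0..1})"
      by (simp only: has_real_derivative_iff_has_vector_derivative)
  qed simp
  moreover have "(?f has_integral real (n + 3) * moment (n + 2) (Suc p)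
      + real (n + 1) * moment n (Suc p) + real (Suc p) * moment (n + 1) p) {0..1}"
    by (intro has_integral_add has_integral_mult_right moment_has_integral)
  ultimately have "real (n + 3) * moment (n + 2) (Suc p)
      + real (n + 1) * moment n (Suc p) + real (Suc p) * moment (n + 1) p = ?g 1 - ?g 0"
    by (rule has_integral_unique[symmetric])
  then show ?thesis by (simp add: arctan_one)
qed

text \<open>The signs and weights absorb the alternation in the moment recursion, so that the
  differences in \<open>n\<close> are exactly the summands of \<open>even_sum\<close> and \<open>odd_sum\<close>.\<close>

definition even_moment :: "nat \<Rightarrow> nat \<Rightarrow> real" where
  "even_moment p n = (- 1) ^ n * real (2 * n + 1) * moment (2 * n) p / fact p"

definition odd_moment :: "nat \<Rightarrow> nat \<Rightarrow> real" where
  "odd_moment p n = alt n * real (2 * n + 2) * moment (2 * n + 1) p / fact p"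

lemma even_moment_Suc_diff:
  "even_moment (Suc p) (Suc n) = even_moment (Suc p) n + 2 * alt n * ((pi / 4) ^ Suc p / fact (Suc p))
    - odd_moment p n / (2 * real n + 2)"
proof -
  define c where "c = real (Suc p)"
  have c: "c \<noteq> 0" "fact (Suc p) = c * (fact p :: real)" by (simp_all add: c_def)
  have m: "real (2 * n + 3) * moment (2 * n + 2) (Suc p) =
      2 * (pi / 4) ^ Suc p - real (2 * n + 1) * moment (2 * n) (Suc p) - c * moment (2 * n + 1) p"
    using moment_Suc[of "2 * n" p] unfolding c_def by linarith
  \<comment> \<open>Here \<open>t\<close> stands for the power of \<open>pi / 4\<close>,
    \<open>k\<close> for the weighted moment of exponent \<open>Suc p\<close>, and \<open>a\<close>
    for the moment of exponent \<open>p\<close>.\<close>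
  have split: "alt n * (2 * t - k - c * a) / (c * fact p) =
      2 * alt n * (t / (c * fact p)) - alt n * k / (c * fact p) - alt n * a / fact p" for t k a
    using c(1) by (simp add: diff_divide_distrib right_diff_distrib)
  have "even_moment (Suc p) (Suc n) =
      alt n * (real (2 * n + 3) * moment (2 * n + 2) (Suc p)) / (c * fact p)"
    unfolding even_moment_def alt_def c(2) by (simp add: numeral_eq_Suc)
  moreover have "odd_moment p n = (2 * real n + 2) * (alt n * moment (2 * n + 1) p / fact p)"
    unfolding odd_moment_def by simp
  then have "odd_moment p n / (2 * real n + 2) = alt n * moment (2 * n + 1) p / fact p"
    by (simp add: nonzero_mult_div_cancel_left)
  moreover have "even_moment (Suc p) n =
      - (alt n * (real (2 * n + 1) * moment (2 * n) (Suc p)) / (c * fact p))"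
    unfolding even_moment_def alt_def c(2) by simp
  ultimately show ?thesis unfolding m split c(2) by linarith
qed

text \<open>The differences telescope from the starting value
  \<open>A_int (Suc p) / fact (Suc p)\<close>; the partial sums of \<open>2 * alt\<close> are
  \<open>- (alt n + 1)\<close>.\<close>

lemma even_moment_Suc:
  "even_moment (Suc p) n = A_int (Suc p) / fact (Suc p) - (pi / 4) ^ Suc p / fact (Suc p) * (alt n + 1)
    - even_sum (odd_moment p) n / 2"
proof (induction n)
  case 0
  show ?case by (simp add: even_moment_def alt_def even_sum_def A_int_def moment_def)
next
  case (Suc n)
  define b :: real where "b = (pi / 4) ^ Suc p / fact (Suc p)"
  have "alt (Suc n) = - alt n" by (simp add: alt_def)
  moreover have "even_sum (odd_moment p) (Suc n) / 2 =
      even_sum (odd_moment p) n / 2 + odd_moment p n / (2 * real n + 2)"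
    by (simp add: even_sum_def)
  ultimately show ?case unfolding even_moment_Suc_diff Suc b_def[symmetric]
    by (simp add: algebra_simps)
qed

lemma odd_moment_zero:
  "odd_moment (Suc p) 0 = even_moment p 0 - 2 * (pi / 4) ^ Suc p / fact (Suc p)"
proof -
  define c where "c = real (Suc p)"
  have c: "c > 0" "fact (Suc p) = c * (fact p :: real)" by (simp_all add: c_def)
  have "odd_moment (Suc p) 0 = - (2 * moment 1 (Suc p)) / fact (Suc p)"
    by (simp add: odd_moment_def alt_def)
  also have "2 * moment 1 (Suc p) = 2 * (pi / 4) ^ Suc p - c * moment 0 p"
    using moment_Suc_zero[of p] unfolding c_def by linarith
  also have "- (2 * (pi / 4) ^ Suc p - c * moment 0 p) / fact (Suc p)
      = c * moment 0 p / fact (Suc p) - 2 * (pi / 4) ^ Suc p / fact (Suc p)"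
    by (simp add: diff_divide_distrib)
  also have "c * moment 0 p / fact (Suc p) = even_moment p 0"
    using c by (simp add: even_moment_def)
  finally show ?thesis .
qed

lemma odd_moment_Suc_diff:
  "odd_moment (Suc p) (Suc n) = odd_moment (Suc p) n - 2 * alt n * ((pi / 4) ^ Suc p / fact (Suc p))
    + even_moment p (Suc n) / (2 * real n + 3)"
proof -
  define c where "c = real (Suc p)"
  have c: "c \<noteq> 0" "fact (Suc p) = c * (fact p :: real)" by (simp_all add: c_def)
  have eq: "2 * n + 1 + 3 = 2 * n + 4" "2 * n + 1 + 2 = 2 * n + 3" "2 * n + 1 + 1 = 2 * n + 2"
    by simp_all
  have m: "real (2 * n + 4) * moment (2 * n + 3) (Suc p) =
      2 * (pi / 4) ^ Suc p - real (2 * n + 2) * moment (2 * n + 1) (Suc p) - c * moment (2 * n + 2) p"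
    using moment_Suc[of "2 * n + 1" p] unfolding c_def eq by linarith
  have split: "- (alt n * (2 * t - k - c * a) / (c * fact p)) =
      alt n * k / (c * fact p) - 2 * alt n * (t / (c * fact p)) + alt n * a / fact p" for t k a
    using c(1) by (simp add: diff_divide_distrib right_diff_distrib)
  have "odd_moment (Suc p) (Suc n) =
      - (alt n * (real (2 * n + 4) * moment (2 * n + 3) (Suc p)) / (c * fact p))"
    unfolding odd_moment_def alt_def c(2) by (simp add: numeral_eq_Suc)
  moreover have "even_moment p (Suc n) = (2 * real n + 3) * (alt n * moment (2 * n + 2) p / fact p)"
    unfolding even_moment_def alt_def by simp
  then have "even_moment p (Suc n) / (2 * real n + 3) = alt n * moment (2 * n + 2) p / fact p"
    by simp
  moreover have "odd_moment (Suc p) n =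
      alt n * (real (2 * n + 2) * moment (2 * n + 1) (Suc p)) / (c * fact p)"
    unfolding odd_moment_def c(2) by simp
  ultimately show ?thesis unfolding m split c(2) by linarith
qed

text \<open>No integral \<open>A_int\<close> enters: by \<open>odd_moment_zero\<close> the starting
  value is a power of \<open>pi / 4\<close> plus the summand \<open>j = 0\<close> of
  \<open>odd_sum\<close>.\<close>

lemma odd_moment_Suc:
  "odd_moment (Suc p) n = (pi / 4) ^ Suc p / fact (Suc p) * (alt n - 1)
    + odd_sum (even_moment p) n / 2"
proof (induction n)
  case 0
  show ?case by (simp add: odd_moment_zero odd_sum_def alt_def)
next
  case (Suc n)
  define b :: real where "b = (pi / 4) ^ Suc p / fact (Suc p)"
  have eq: "2 * real (Suc n) + 1 = 2 * real n + 3" by simp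
  have "alt (Suc n) = - alt n" by (simp add: alt_def)
  moreover have "odd_sum (even_moment p) (Suc n) / 2 =
      odd_sum (even_moment p) n / 2 + even_moment p (Suc n) / (2 * real n + 3)"
    unfolding odd_sum_def sum.atMost_Suc eq by simp
  ultimately show ?case unfolding odd_moment_Suc_diff Suc b_def[symmetric]
    by (simp add: algebra_simps)
qed

lemma even_moment_0: "even_moment 0 = (\<lambda>n. - alt n)"
  by (rule ext) (simp add: even_moment_def alt_def moment_power_zero)

lemma odd_moment_0: "odd_moment 0 = alt"
  by (rule ext) (simp add: odd_moment_def moment_power_zero)

section \<open>From the integral to a series of moments\<close>

lemma alternating_sum_bounds:
  fixes a :: "nat \<Rightarrow> real"
  assumes "\<And>n. 0 \<le> a n" "\<And>n. a (Suc n) \<le> a n"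
  shows "0 \<le> (\<Sum>k<n. (- 1) ^ k * a (k + i)) \<and> (\<Sum>k<n. (- 1) ^ k * a (k + i)) \<le> a i"
proof (induction n arbitrary: i)
  case (Suc n)
  \<comment> \<open>Removing the first term leaves the negated sum with offset \<open>Suc i\<close>,
    which lies between 0 and \<open>a (Suc i)\<close>; hence the arbitrary offset.\<close>
  have "(\<Sum>k<Suc n. (- 1) ^ k * a (k + i)) = a i - (\<Sum>k<n. (- 1) ^ k * a (k + Suc i))"
    by (simp add: sum.lessThan_Suc_shift sum_negf del: sum.lessThan_Suc)
  then show ?case using Suc[of "Suc i"] assms(2)[of i] by linarith
qed (simp add: assms)

text \<open>On the unit interval the partial sums of the series of \<open>arctan x / x\<close> are
  at most 1 in absolute value, endpoint included, so \<open>arctan x ^ p\<close> dominates and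
  termwise integration is allowed.\<close>

lemma integral_arctan_power_over_x:
  assumes "p \<ge> 1"
  shows "integral {0..1} (\<lambda>x::real. arctan x ^ Suc p / x) = fact p * outer (even_moment p)"
proof -
  define f where "f N x = (\<Sum>k<N. (- 1) ^ k / real (2 * k + 1) * (x ^ (2 * k) * arctan x ^ p))"
    for N and x :: real
  have int: "(f N has_integral (\<Sum>k<N. (- 1) ^ k / real (2 * k + 1) * moment (2 * k) p)) {0..1}" for N
    unfolding f_def by (intro has_integral_sum has_integral_mult_right moment_has_integral) simp
  have lim: "(\<lambda>N. integral {0..1} (f N)) \<longlonglongrightarrow> integral {0..1} (\<lambda>x. arctan x ^ Suc p / x)"
  proof (rule dominated_convergence(2))
    show "f N integrable_on {0..1}" for N using int by blast
    show "(\<lambda>x. arctan x ^ p) integrable_on {0..1::real}"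
      by (intro integrable_continuous_interval continuous_intros)
    fix x :: real assume x: "x \<in> {0..1}"
    have eq: "f N x = arctan x ^ p * (\<Sum>k<N. (- 1) ^ k * (x ^ (2 * k) / real (2 * k + 1)))" for N
      by (simp add: f_def sum_distrib_left algebra_simps)
    show "norm (f N x) \<le> arctan x ^ p" for N
    proof -
      define a where "a k = x ^ (2 * k) / real (2 * k + 1)" for k
      have a: "0 \<le> a k" for k using x by (simp add: a_def)
      have dec: "a (Suc k) \<le> a k" for k
        unfolding a_def using x by (intro frac_le power_decreasing) auto
      have "\<bar>\<Sum>k<N. (- 1) ^ k * a k\<bar> \<le> a 0"
        using alternating_sum_bounds[of a 0 N, OF a dec] by simp
      also have "a 0 = 1" by (simp add: a_def)
      finally have "\<bar>\<Sum>k<N. (- 1) ^ k * a k\<bar> \<le> 1" .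
      then have "arctan x ^ p * \<bar>\<Sum>k<N. (- 1) ^ k * a k\<bar> \<le> arctan x ^ p * 1"
        using x by (intro mult_left_mono) auto
      then show ?thesis unfolding eq a_def[symmetric] using x by (simp add: abs_mult)
    qed
    show "(\<lambda>N. f N x) \<longlonglongrightarrow> arctan x ^ Suc p / x"
    proof (cases "x = 0")
      \<comment> \<open>Division by zero makes the limit 0 here, and \<open>p \<ge> 1\<close> makes
        every partial sum 0.\<close>
      case True
      then have "f N x = 0" for N unfolding eq using assms by simp
      then show ?thesis using True by simp
    next
      case False
      have "(\<lambda>k. (- 1) ^ k * (1 / real (k * 2 + 1) * x ^ (k * 2 + 1))) sums arctan x"
        using x summable_sums[OF summable_arctan_series[of x]] arctan_series[of x] by simp
      then have "(\<lambda>k. arctan x ^ p / x * ((- 1) ^ k * (1 / real (k * 2 + 1) * x ^ (k * 2 + 1))))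
          sums (arctan x ^ p / x * arctan x)"
        by (rule sums_mult)
      moreover have "arctan x ^ p / x * ((- 1) ^ k * (1 / real (k * 2 + 1) * x ^ (k * 2 + 1)))
          = (- 1) ^ k / real (2 * k + 1) * (x ^ (2 * k) * arctan x ^ p)" for k
        using False by (simp add: field_simps)
      ultimately show ?thesis
        by (simp add: sums_def f_def mult.commute)
    qed
  qed
  \<comment> \<open>The normalisation of \<open>even_moment\<close> contains one more factor
    \<open>2 * k + 1\<close>, which turns the weight into a square.\<close>
  have coeff: "(- 1) ^ k / real (2 * k + 1) * moment (2 * k) p
      = fact p * (even_moment p k / (2 * real k + 1)\<^sup>2)" for k
    by (simp add: even_moment_def power2_eq_square add.commute)
  have "(\<lambda>k. fact p * (even_moment p k / (2 * real k + 1)\<^sup>2))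
      sums integral {0..1} (\<lambda>x::real. arctan x ^ Suc p / x)"
    using lim by (simp only: sums_def integral_unique[OF int] coeff)
  then have "(\<lambda>k. (fact p * (even_moment p k / (2 * real k + 1)\<^sup>2)) / fact p)
      sums (integral {0..1} (\<lambda>x::real. arctan x ^ Suc p / x) / fact p)"
    by (rule sums_divide)
  then show ?thesis by (simp add: outer_def sums_iff)
qed

section \<open>Unrolling the recursion\<close>

text \<open>Both kinds are treated together, because each at exponent \<open>Suc p\<close> is a sum
  over the other at exponent \<open>p\<close>.\<close>

lemma sqrt_bounded_moments: "sqrt_bounded (even_moment p) \<and> sqrt_bounded (odd_moment p)"
proof (induction p)
  case 0
  show ?case
    using sqrt_bounded_lincomb[OF sqrt_bounded_alt sqrt_bounded_alt, of "-1" 0]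
    by (simp add: even_moment_0 odd_moment_0 sqrt_bounded_alt)
next
  case (Suc p)
  define a b :: real where "a = A_int (Suc p) / fact (Suc p)"
    and "b = (pi / 4) ^ Suc p / fact (Suc p)"
  note affine = sqrt_bounded_lincomb[OF sqrt_bounded_one sqrt_bounded_alt]
  have e: "even_moment (Suc p) =
      (\<lambda>n. 1 * ((a - b) * 1 + (- b) * alt n) + (- 1 / 2) * even_sum (odd_moment p) n)"
    by (rule ext) (simp only: even_moment_Suc flip: a_def b_def, simp add: algebra_simps)
  have o: "odd_moment (Suc p) =
      (\<lambda>n. 1 * ((- b) * 1 + b * alt n) + (1 / 2) * odd_sum (even_moment p) n)"
    by (rule ext) (simp only: odd_moment_Suc flip: b_def, simp add: algebra_simps)
  show ?case unfolding e o
    using Suc by (intro conjI sqrt_bounded_lincomb affine sqrt_bounded_even_sum sqrt_bounded_odd_sum) auto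
qed

lemma value_of_even_moment_Suc:
  "value_of k (even_moment (Suc p)) = A_int (Suc p) / fact (Suc p) * value_of k (\<lambda>n. 1)
    - (pi / 4) ^ Suc p / fact (Suc p) * (value_of k alt + value_of k (\<lambda>n. 1))
    - value_of k (even_sum (odd_moment p)) / 2"
proof -
  define a b :: real where "a = A_int (Suc p) / fact (Suc p)"
    and "b = (pi / 4) ^ Suc p / fact (Suc p)"
  have eq: "even_moment (Suc p) =
      (\<lambda>n. 1 * ((a - b) * 1 + (- b) * alt n) + (- 1 / 2) * even_sum (odd_moment p) n)"
    by (rule ext) (simp only: even_moment_Suc flip: a_def b_def, simp add: algebra_simps)
  have "value_of k (even_moment (Suc p)) = 1 * value_of k (\<lambda>n. (a - b) * 1 + (- b) * alt n)
      + (- 1 / 2) * value_of k (even_sum (odd_moment p))"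
    unfolding eq by (intro value_of_lincomb sqrt_bounded_lincomb sqrt_bounded_one sqrt_bounded_alt
        sqrt_bounded_even_sum sqrt_bounded_moments[THEN conjunct2])
  also have "value_of k (\<lambda>n. (a - b) * 1 + (- b) * alt n)
      = (a - b) * value_of k (\<lambda>n. 1) + (- b) * value_of k alt"
    by (intro value_of_lincomb sqrt_bounded_one sqrt_bounded_alt)
  finally show ?thesis
    unfolding a_def[symmetric] b_def[symmetric] by (simp add: algebra_simps)
qed

text \<open>The outer \<open>even_sum\<close> meets the \<open>odd_sum\<close> of the recursion and
  completes a \<open>double_sum\<close>, so the level rises to \<open>Suc k\<close>.\<close>

lemma value_of_even_sum_odd_moment_Suc:
  "value_of k (even_sum (odd_moment (Suc p))) =
    (pi / 4) ^ Suc p / fact (Suc p) * (value_of k (even_sum alt) - value_of k (even_sum (\<lambda>n. 1)))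
    + value_of (Suc k) (even_moment p) / 2"
proof -
  define b :: real where "b = (pi / 4) ^ Suc p / fact (Suc p)"
  have "odd_moment (Suc p) =
      (\<lambda>n. 1 * ((- b) * 1 + b * alt n) + (1 / 2) * odd_sum (even_moment p) n)"
    by (rule ext) (simp only: odd_moment_Suc flip: b_def, simp add: algebra_simps)
  then have eq: "even_sum (odd_moment (Suc p)) = (\<lambda>n. 1 * ((- b) * even_sum (\<lambda>n. 1) n
      + b * even_sum alt n) + (1 / 2) * double_sum (even_moment p) n)"
    by (simp only: even_sum_lincomb double_sum_def)
  have "value_of k (even_sum (odd_moment (Suc p))) =
      1 * value_of k (\<lambda>n. (- b) * even_sum (\<lambda>n. 1) n + b * even_sum alt n)
      + (1 / 2) * value_of k (double_sum (even_moment p))"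
    unfolding eq double_sum_def
    by (intro value_of_lincomb sqrt_bounded_lincomb sqrt_bounded_one sqrt_bounded_alt
        sqrt_bounded_even_sum sqrt_bounded_odd_sum sqrt_bounded_moments[THEN conjunct1])
  also have "value_of k (\<lambda>n. (- b) * even_sum (\<lambda>n. 1) n + b * even_sum alt n)
      = (- b) * value_of k (even_sum (\<lambda>n. 1)) + b * value_of k (even_sum alt)"
    by (intro value_of_lincomb sqrt_bounded_one sqrt_bounded_alt sqrt_bounded_even_sum)
  finally show ?thesis
    unfolding b_def[symmetric] value_of_double_sum by (simp add: algebra_simps)
qed

text \<open>Boundary terms of lowering the exponent from \<open>p\<close> to \<open>p - 2\<close>;
  the last one stems from the odd moment of exponent \<open>p - 1\<close>.\<close>

definition step_term :: "nat \<Rightarrow> nat \<Rightarrow> real" where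
  "step_term k p = A_int p / fact p * value_of k (\<lambda>n. 1)
    - (pi / 4) ^ p / fact p * (value_of k alt + value_of k (\<lambda>n. 1))
    - (pi / 4) ^ (p - 1) / fact (p - 1)
      * (value_of k (even_sum alt) - value_of k (even_sum (\<lambda>n. 1))) / 2"

lemma value_of_even_moment_step:
  "value_of k (even_moment (p + 2)) = step_term k (p + 2) - value_of (Suc k) (even_moment p) / 4"
proof -
  have "p + 2 = Suc (Suc p)" "Suc (Suc p) - 1 = Suc p" by simp_all
  then show ?thesis
    unfolding value_of_even_moment_Suc value_of_even_sum_odd_moment_Suc step_term_def
    by (simp only: value_of_even_moment_Suc value_of_even_sum_odd_moment_Suc add_divide_distrib)
qed

text \<open>Every double step contributes a factor \<open>-1/4\<close> and raises the level by one,
  so the induction must vary \<open>k\<close>.\<close>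

lemma value_of_even_moment_unroll:
  "value_of k (even_moment (p + 2 * m)) =
    (\<Sum>u<m. (- 1) ^ u / 2 ^ (2 * u) * step_term (k + u) (p + 2 * m - 2 * u))
    + (- 1) ^ m / 2 ^ (2 * m) * value_of (k + m) (even_moment p)"
proof (induction m arbitrary: k)
  case (Suc m)
  have "value_of k (even_moment (p + 2 * Suc m)) = value_of k (even_moment (p + 2 * m + 2))"
    by simp
  also have "\<dots> = step_term k (p + 2 * m + 2) - value_of (Suc k) (even_moment (p + 2 * m)) / 4"
    by (rule value_of_even_moment_step)
  finally show ?case unfolding Suc
    by (simp add: sum.lessThan_Suc_shift sum_divide_distrib sum_negf diff_divide_distrib
        add_divide_distrib mult.commute del: sum.lessThan_Suc)
qed simp

lemma sum_step_term:
  "(\<Sum>u<m. (- 1) ^ u / 2 ^ (2 * u) * step_term u (p - 2 * u)) =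
    (\<Sum>u<m. (- 1) ^ u / 2 ^ (2 * u) * (A_int (p - 2 * u) / fact (p - 2 * u)) * value_of u (\<lambda>n. 1))
    - (\<Sum>u<m. (- 1) ^ u / 2 ^ (2 * u) * ((pi / 4) ^ (p - 2 * u) / fact (p - 2 * u))
        * (value_of u alt + value_of u (\<lambda>n. 1)))
    - (\<Sum>u<m. (- 1) ^ u / 2 ^ (2 * u + 1)
        * ((pi / 4) ^ (p - 2 * u - 1) / fact (p - 2 * u - 1))
        * (value_of u (even_sum alt) - value_of u (even_sum (\<lambda>n. 1))))"
  unfolding sum_subtractf[symmetric] step_term_def
  by (intro sum.cong refl) (simp add: algebra_simps diff_divide_distrib add_divide_distrib)

lemma outer_even_moment_odd:
  "outer (even_moment (2 * m + 1)) =
    (\<Sum>u<Suc m. (- 1) ^ u / 2 ^ (2 * u) * (A_int (2 * m + 1 - 2 * u) / fact (2 * m + 1 - 2 * u))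
        * value_of u (\<lambda>n. 1))
    - (\<Sum>u<Suc m. (- 1) ^ u / 2 ^ (2 * u)
        * ((pi / 4) ^ (2 * m + 1 - 2 * u) / fact (2 * m + 1 - 2 * u))
        * (value_of u alt + value_of u (\<lambda>n. 1)))
    - (\<Sum>u<m. (- 1) ^ u / 2 ^ (2 * u + 1)
        * ((pi / 4) ^ (2 * m + 1 - 2 * u - 1) / fact (2 * m + 1 - 2 * u - 1))
        * (value_of u (even_sum alt) - value_of u (even_sum (\<lambda>n. 1))))
    - (- 1) ^ m / 2 ^ (2 * m + 1) * value_of m (even_sum alt)"
proof -
  \<comment> \<open>After \<open>m\<close> double steps exponent 1 remains. One single step ends at
    \<open>odd_moment 0\<close>, supplying the terms \<open>u = m\<close> of the first two sums and
    the isolated last term.\<close>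
  have step: "value_of m (even_moment 1) = A_int 1 * value_of m (\<lambda>n. 1)
    - pi / 4 * (value_of m alt + value_of m (\<lambda>n. 1)) - value_of m (even_sum alt) / 2"
    using value_of_even_moment_Suc[of m 0] by (simp add: odd_moment_0)
  have "outer (even_moment (2 * m + 1)) =
      (\<Sum>u<m. (- 1) ^ u / 2 ^ (2 * u) * step_term u (2 * m + 1 - 2 * u))
      + (- 1) ^ m / 2 ^ (2 * m) * value_of m (even_moment 1)"
    using value_of_even_moment_unroll[of 0 1 m] by (simp add: value_of_def[of 0])
  \<comment> \<open>The divisions by 1 anticipate \<open>fact 1\<close> in the terms
    \<open>u = m\<close>.\<close>
  moreover have "S1 - S2 - S3 + c * (x * y - pi / 4 * z - w / 2) =
      (S1 + c * (x / 1) * y) - (S2 + c * (pi / 4 / 1) * z) - S3 - c / 2 * w"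
    for S1 S2 S3 c x y z w :: real
    by (simp add: algebra_simps)
  moreover have "2 * m + 1 - 2 * m = 1" "(- 1) ^ m / 2 ^ (2 * m + 1) = ((- 1) ^ m / 2 ^ (2 * m) / 2 :: real)"
    by simp_all
  ultimately show ?thesis
    unfolding sum_step_term step sum.lessThan_Suc by (simp only: fact_1 power_one_right)
qed

lemma outer_even_moment_even:
  "outer (even_moment (2 * m)) =
    (\<Sum>u<m. (- 1) ^ u / 2 ^ (2 * u) * (A_int (2 * m - 2 * u) / fact (2 * m - 2 * u))
        * value_of u (\<lambda>n. 1))
    - (\<Sum>u<m. (- 1) ^ u / 2 ^ (2 * u) * ((pi / 4) ^ (2 * m - 2 * u) / fact (2 * m - 2 * u))
        * (value_of u alt + value_of u (\<lambda>n. 1)))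
    - (\<Sum>u<m. (- 1) ^ u / 2 ^ (2 * u + 1)
        * ((pi / 4) ^ (2 * m - 2 * u - 1) / fact (2 * m - 2 * u - 1))
        * (value_of u (even_sum alt) - value_of u (even_sum (\<lambda>n. 1))))
    - (- 1) ^ m / 2 ^ (2 * m) * value_of m alt"
proof -
  have "value_of m (even_moment 0) = - value_of m alt"
    using value_of_lincomb[OF sqrt_bounded_alt sqrt_bounded_alt, of m "-1" 0]
    by (simp add: even_moment_0)
  then show ?thesis
    using value_of_even_moment_unroll[of 0 0 m] sum_step_term[of "2 * m" m]
    by (simp add: value_of_def[of 0])
qed

section \<open>Assembly of the two formulas\<close>

lemma sum_from_one:
  fixes f :: "nat \<Rightarrow> real"
  shows "m \<ge> 1 \<Longrightarrow> (\<Sum>v = 1..m - 1. f v) = (\<Sum>v<m. f v) - f 0"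
  by (cases m) (simp_all add: sum.lessThan_Suc_shift sum.atLeast1_atMost_eq del: sum.lessThan_Suc)

theorem theorem4p6:
  fixes m :: nat
  assumes "m \<ge> 1"
  shows "(integral {0..1} (\<lambda>x::real. arctan x ^ (2 * m) / x) =
      t_val (bar 1) ^ (2 * m - 1) * (t_val (bar 2) + t_val (nobar 2))
    + (- 1) ^ m * fact (2 * m - 1) / 2 ^ (2 * m)
        * S_val (nobar 2 # ones (2 * m - 2) @ [bar 1])
    + fact (2 * m - 1) * (\<Sum>u = 0..m - 1.
        (- 1) ^ u * A_int (2 * m - 2 * u - 1) / (fact (2 * m - 2 * u - 1) * 2 ^ (2 * u + 1))
          * T_val (nobar 2 # ones (2 * u)))
    - fact (2 * m - 1) * (\<Sum>v = 1..m - 1.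
        (- 1) ^ (v + 1) * t_val (bar 1) ^ (2 * m - 2 * v - 1)
          / (2 ^ (2 * v + 1) * fact (2 * m - 2 * v - 1))
          * (T_val (nobar 2 # ones (2 * v)) + T_val (nobar 2 # ones (2 * v - 1) @ [bar 1])))
    - fact (2 * m - 1) * (\<Sum>v = 1..m - 1.
        (- 1) ^ v * t_val (bar 1) ^ (2 * m - 2 * v)
          / (2 ^ (2 * v) * fact (2 * m - 2 * v))
          * (S_val (nobar 2 # ones (2 * v - 1)) - S_val (nobar 2 # ones (2 * v - 2) @ [bar 1]))))
  \<and> (integral {0..1} (\<lambda>x::real. arctan x ^ (2 * m + 1) / x) =
    - (t_val (bar 1) ^ (2 * m)) * (t_val (bar 2) + t_val (nobar 2))
    - (- 1) ^ m * fact (2 * m) / 2 ^ (2 * m + 1)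
        * T_val (nobar 2 # ones (2 * m - 1) @ [bar 1])
    + fact (2 * m) * (\<Sum>u = 0..m - 1.
        (- 1) ^ u * A_int (2 * m - 2 * u) / (fact (2 * m - 2 * u) * 2 ^ (2 * u + 1))
          * T_val (nobar 2 # ones (2 * u)))
    - fact (2 * m) * (\<Sum>v = 1..m - 1.
        (- 1) ^ v * t_val (bar 1) ^ (2 * m - 2 * v)
          / (2 ^ (2 * v + 1) * fact (2 * m - 2 * v))
          * (T_val (nobar 2 # ones (2 * v)) + T_val (nobar 2 # ones (2 * v - 1) @ [bar 1])))
    - fact (2 * m) * (\<Sum>v = 0..m - 1.
        (- 1) ^ v * t_val (bar 1) ^ (2 * m - 2 * v - 1)
          / (2 ^ (2 * v + 2) * fact (2 * m - 2 * v - 1))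
          * (S_val (nobar 2 # ones (2 * v + 1)) - S_val (nobar 2 # ones (2 * v) @ [bar 1]))))"
  (is "?even \<and> ?odd")
proof
  let ?tau = "pi / 4 :: real"
  have range: "{0..m - 1} = {..<m}" using assms by auto
  \<comment> \<open>For \<open>v \<ge> 1\<close> the subtraction is not truncated and the word has
    \<open>2 * (v - 1) + 1\<close> ones.\<close>
  have T_bar: "T_val (nobar 2 # ones (2 * v - 1) @ [bar 1]) = 2 * value_of v alt" if v: "v \<ge> 1" for v
  proof -
    have "2 * v - 1 = 2 * (v - 1) + 1" "Suc (v - 1) = v" using v by simp_all
    then show ?thesis using T_val_ones_bar[of "v - 1"] by simp
  qed
  show ?even
  proof -
    obtain k where k: "m = Suc k" using assms by (cases m) auto
    define r :: real where "r = fact (2 * k + 1)"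
    define a where "a u = (- 1) ^ u / 2 ^ (2 * u) * (A_int (2 * k + 1 - 2 * u) / fact (2 * k + 1 - 2 * u))
        * value_of u (\<lambda>n. 1)" for u
    define g where "g u = (- 1) ^ u / 2 ^ (2 * u)
        * (?tau ^ (2 * k + 1 - 2 * u) / fact (2 * k + 1 - 2 * u))
        * (value_of u alt + value_of u (\<lambda>n. 1))" for u
    define h where "h u = (- 1) ^ u / 2 ^ (2 * u + 1)
        * (?tau ^ (2 * k + 1 - 2 * u - 1) / fact (2 * k + 1 - 2 * u - 1))
        * (value_of u (even_sum alt) - value_of u (even_sum (\<lambda>n. 1)))" for u
    define x where "x = (- 1) ^ k / 2 ^ (2 * k + 1) * value_of k (even_sum alt)"
    have p: "2 * m - 1 = 2 * k + 1" "2 * m = Suc (2 * k + 1)" "2 * m - 2 = 2 * k" by (simp_all add: k)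
    have r: "r \<noteq> 0" by (simp add: r_def)
    have "integral {0..1} (\<lambda>x::real. arctan x ^ (2 * m) / x) = r * outer (even_moment (2 * k + 1))"
      unfolding p(2) r_def by (rule integral_arctan_power_over_x) simp
    also have "outer (even_moment (2 * k + 1)) =
        (\<Sum>u<m. a u) - (\<Sum>u<m. g u) - (\<Sum>u<k. h u) - x"
      unfolding a_def g_def h_def x_def k by (rule outer_even_moment_odd)
    finally have int: "integral {0..1} (\<lambda>x::real. arctan x ^ (2 * m) / x) =
        r * ((\<Sum>u<m. a u) - (\<Sum>u<m. g u) - (\<Sum>u<k. h u) - x)" .
    \<comment> \<open>The product of \<open>t\<close>-values is the term \<open>u = 0\<close> of the
      sum over \<open>g\<close>; the odd power of \<open>- (pi / 4)\<close> gives the sign.\<close>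
    have e1: "t_val (bar 1) ^ (2 * m - 1) * (t_val (bar 2) + t_val (nobar 2)) = - (r * g 0)"
      using r unfolding p t_val_bar_one t_val_bar_two t_val_nobar_two g_def r_def
      by simp
    have e2: "(- 1) ^ m * fact (2 * m - 1) / 2 ^ (2 * m)
        * S_val (nobar 2 # ones (2 * m - 2) @ [bar 1]) = - (r * x)"
      unfolding p(1,3) S_val_ones_bar x_def r_def by (simp add: k)
    have e3: "(\<Sum>u = 0..m - 1. (- 1) ^ u * A_int (2 * m - 2 * u - 1)
        / (fact (2 * m - 2 * u - 1) * 2 ^ (2 * u + 1)) * T_val (nobar 2 # ones (2 * u))) = (\<Sum>u<m. a u)"
      unfolding range
    proof (rule sum.cong[OF refl])
      fix u
      have "2 * m - 2 * u - 1 = 2 * k + 1 - 2 * u" by (simp add: k)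
      then show "(- 1) ^ u * A_int (2 * m - 2 * u - 1) / (fact (2 * m - 2 * u - 1) * 2 ^ (2 * u + 1))
          * T_val (nobar 2 # ones (2 * u)) = a u"
        by (simp only: a_def T_val_ones) (simp add: mult_ac)
    qed
    have e4: "(\<Sum>v = 1..m - 1. (- 1) ^ (v + 1) * t_val (bar 1) ^ (2 * m - 2 * v - 1)
          / (2 ^ (2 * v + 1) * fact (2 * m - 2 * v - 1))
          * (T_val (nobar 2 # ones (2 * v)) + T_val (nobar 2 # ones (2 * v - 1) @ [bar 1])))
        = (\<Sum>u<m. g u) - g 0"
      unfolding sum_from_one[OF assms, of g, symmetric]
    proof (rule sum.cong[OF refl])
      fix v assume v: "v \<in> {1..m - 1}"
      have idx: "2 * m - 2 * v - 1 = 2 * k + 1 - 2 * v" by (simp add: k)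
      have odd: "odd (2 * k + 1 - 2 * v)" using v by (simp add: k)
      have v1: "v \<ge> 1" using v by simp
      show "(- 1) ^ (v + 1) * t_val (bar 1) ^ (2 * m - 2 * v - 1)
          / (2 ^ (2 * v + 1) * fact (2 * m - 2 * v - 1))
          * (T_val (nobar 2 # ones (2 * v)) + T_val (nobar 2 # ones (2 * v - 1) @ [bar 1])) = g v"
        unfolding idx t_val_bar_one power_minus_odd[OF odd] T_val_ones T_bar[OF v1] g_def
        by (simp add: field_simps)
    qed
    \<comment> \<open>Substituting \<open>v = Suc u\<close> flips the sign, which reverses the
      difference of the two \<open>S\<close>-values.\<close>
    have e5: "(\<Sum>v = 1..m - 1. (- 1) ^ v * t_val (bar 1) ^ (2 * m - 2 * v)
          / (2 ^ (2 * v) * fact (2 * m - 2 * v))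
          * (S_val (nobar 2 # ones (2 * v - 1)) - S_val (nobar 2 # ones (2 * v - 2) @ [bar 1])))
        = (\<Sum>u<k. h u)"
    proof -
      have range: "{1..m - 1} = {Suc 0..k}" by (simp add: k)
      show ?thesis unfolding range sum.atLeast1_atMost_eq
      proof (rule sum.cong[OF refl])
        fix u assume u: "u \<in> {..<k}"
        have idx: "2 * m - 2 * Suc u = 2 * k - 2 * u" "2 * k + 1 - 2 * u - 1 = 2 * k - 2 * u"
          "2 * Suc u - 1 = 2 * u + 1" "2 * Suc u - 2 = 2 * u" by (simp_all add: k)
        have even: "even (2 * k - 2 * u)" by simp
        show "(- 1) ^ Suc u * t_val (bar 1) ^ (2 * m - 2 * Suc u)
            / (2 ^ (2 * Suc u) * fact (2 * m - 2 * Suc u))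
            * (S_val (nobar 2 # ones (2 * Suc u - 1)) - S_val (nobar 2 # ones (2 * Suc u - 2) @ [bar 1]))
          = h u"
          unfolding h_def idx t_val_bar_one power_minus_even[OF even] S_val_ones S_val_ones_bar
          by (simp add: field_simps)
      qed
    qed
    show ?thesis
      unfolding int e1 e2 e3 e4 e5 unfolding p(1) r_def[symmetric] by (simp add: algebra_simps)
  qed
  show ?odd
  proof -
    define r :: real where "r = fact (2 * m)"
    define a where "a u = (- 1) ^ u / 2 ^ (2 * u) * (A_int (2 * m - 2 * u) / fact (2 * m - 2 * u))
        * value_of u (\<lambda>n. 1)" for u
    define g where "g u = (- 1) ^ u / 2 ^ (2 * u) * (?tau ^ (2 * m - 2 * u) / fact (2 * m - 2 * u))
        * (value_of u alt + value_of u (\<lambda>n. 1))" for u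
    define h where "h u = (- 1) ^ u / 2 ^ (2 * u + 1)
        * (?tau ^ (2 * m - 2 * u - 1) / fact (2 * m - 2 * u - 1))
        * (value_of u (even_sum alt) - value_of u (even_sum (\<lambda>n. 1)))" for u
    define x where "x = (- 1) ^ m / 2 ^ (2 * m) * value_of m alt"
    have r: "r \<noteq> 0" by (simp add: r_def)
    have "integral {0..1} (\<lambda>x::real. arctan x ^ (2 * m + 1) / x) = r * outer (even_moment (2 * m))"
      unfolding Suc_eq_plus1[symmetric] r_def
      by (rule integral_arctan_power_over_x) (use assms in simp)
    also have "outer (even_moment (2 * m)) =
        (\<Sum>u<m. a u) - (\<Sum>u<m. g u) - (\<Sum>u<m. h u) - x"
      unfolding a_def g_def h_def x_def by (rule outer_even_moment_even)
    finally have int: "integral {0..1} (\<lambda>x::real. arctan x ^ (2 * m + 1) / x) =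
        r * ((\<Sum>u<m. a u) - (\<Sum>u<m. g u) - (\<Sum>u<m. h u) - x)" .
    have e1: "- (t_val (bar 1) ^ (2 * m)) * (t_val (bar 2) + t_val (nobar 2)) = - (r * g 0)"
      using r unfolding t_val_bar_one t_val_bar_two t_val_nobar_two g_def r_def
      by simp
    have e2: "(- 1) ^ m * fact (2 * m) / 2 ^ (2 * m + 1)
        * T_val (nobar 2 # ones (2 * m - 1) @ [bar 1]) = r * x"
      unfolding T_bar[OF assms] x_def r_def by simp
    have e3: "(\<Sum>u = 0..m - 1. (- 1) ^ u * A_int (2 * m - 2 * u)
        / (fact (2 * m - 2 * u) * 2 ^ (2 * u + 1)) * T_val (nobar 2 # ones (2 * u))) = (\<Sum>u<m. a u)"
      unfolding range by (intro sum.cong refl) (simp only: a_def T_val_ones, simp add: mult_ac)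
    have e4: "(\<Sum>v = 1..m - 1. (- 1) ^ v * t_val (bar 1) ^ (2 * m - 2 * v)
          / (2 ^ (2 * v + 1) * fact (2 * m - 2 * v))
          * (T_val (nobar 2 # ones (2 * v)) + T_val (nobar 2 # ones (2 * v - 1) @ [bar 1])))
        = (\<Sum>u<m. g u) - g 0"
      unfolding sum_from_one[OF assms, of g, symmetric]
    proof (rule sum.cong[OF refl])
      fix v assume v: "v \<in> {1..m - 1}"
      have even: "even (2 * m - 2 * v)" by simp
      have v1: "v \<ge> 1" using v by simp
      show "(- 1) ^ v * t_val (bar 1) ^ (2 * m - 2 * v)
          / (2 ^ (2 * v + 1) * fact (2 * m - 2 * v))
          * (T_val (nobar 2 # ones (2 * v)) + T_val (nobar 2 # ones (2 * v - 1) @ [bar 1])) = g v"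
        unfolding t_val_bar_one power_minus_even[OF even] T_val_ones T_bar[OF v1] g_def
        by (simp add: field_simps)
    qed
    \<comment> \<open>No shift occurs here; the odd power of \<open>- (pi / 4)\<close> reverses the
      difference instead.\<close>
    have e5: "(\<Sum>v = 0..m - 1. (- 1) ^ v * t_val (bar 1) ^ (2 * m - 2 * v - 1)
          / (2 ^ (2 * v + 2) * fact (2 * m - 2 * v - 1))
          * (S_val (nobar 2 # ones (2 * v + 1)) - S_val (nobar 2 # ones (2 * v) @ [bar 1])))
        = (\<Sum>u<m. h u)"
      unfolding range
    proof (rule sum.cong[OF refl])
      fix v assume v: "v \<in> {..<m}"
      have odd: "odd (2 * m - 2 * v - 1)" using v by simp
      show "(- 1) ^ v * t_val (bar 1) ^ (2 * m - 2 * v - 1)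
          / (2 ^ (2 * v + 2) * fact (2 * m - 2 * v - 1))
          * (S_val (nobar 2 # ones (2 * v + 1)) - S_val (nobar 2 # ones (2 * v) @ [bar 1])) = h v"
        unfolding t_val_bar_one power_minus_odd[OF odd] S_val_ones S_val_ones_bar h_def
        by (simp add: field_simps)
    qed
    show ?thesis
      unfolding int e1 e2 e3 e4 e5 unfolding r_def[symmetric] by (simp add: algebra_simps)
  qed
qed

end
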